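(* Let $C$ be a field of characteristic zero, $\Gamma\in\{\mathbb Z,\mathbb Q\}$, and $K=C((t^\Gamma))$ equipped with its valuation and with the derivation $t\frac{d}{dt}$. Then the theory of the valued differential field $K$ is undecidable.
   Context: $C((t^\Gamma))$ is the Hahn field of series $\sum_\gamma f_\gamma t^\gamma$ ($f_\gamma\in C$) with well-ordered support, with valuation ring $\{f:\operatorname{supp}f\subseteq\Gamma^{\ge0}\}$. The derivation $t\frac{d}{dt}$ is trivial on $C$, sends $t^\gamma$ to $\gamma t^\gamma$, and acts termwise: $\sum f_\gamma t^\gamma\mapsto\sum\gamma f_\gamma t^\gamma$. *)

theory Defs
  imports Complex_Main "HOL-Library.Nat_Bijection"
begin

section \<open>Well-ordered subsets of ordered abelian groups\<close>

lemma wfp_on_less_least: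
  fixes S :: "'a::linorder set"
  assumes "wfp_on S (<)" "A \<subseteq> S" "A \<noteq> {}"
  obtains z where "z \<in> A" "\<And>y. y \<in> A \<Longrightarrow> z \<le> y"
proof -
  have "\<exists>z\<in>A. \<forall>y. y < z \<longrightarrow> y \<notin> A"
    using assms(1)[unfolded wfp_on_iff_ex_minimal, rule_format, OF assms(2,3)] by simp
  then obtain z where z: "z \<in> A" "\<forall>y. y < z \<longrightarrow> y \<notin> A" by (rule bexE)
  have "z \<le> y" if "y \<in> A" for y
    using z(2)[rule_format, of y] that by (cases "y < z") simp_all
  then show thesis using that z(1) by simp
qed

lemma wfp_on_less_iff_no_descending:
  fixes S :: "'a::linorder set"
  shows "wfp_on S (<) \<longleftrightarrow> \<not> (\<exists>s. \<forall>n::nat. s n \<in> S \<and> s (Suc n) < s n)"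
proof
  assume wf: "wfp_on S (<)"
  show "\<not> (\<exists>s. \<forall>n::nat. s n \<in> S \<and> s (Suc n) < s n)"
  proof
    assume "\<exists>s. \<forall>n::nat. s n \<in> S \<and> s (Suc n) < s n"
    then obtain s where s: "\<And>n::nat. s n \<in> S" "\<And>n. s (Suc n) < s n" by blast
    have "range s \<subseteq> S" "range s \<noteq> {}" using s(1) by auto
    then obtain z where z: "z \<in> range s" "\<And>y. y \<in> range s \<Longrightarrow> z \<le> y"
      using wfp_on_less_least[OF wf] by metis
    then obtain n where "z = s n" by auto
    then show False using s(2)[of n] z(2)[of "s (Suc n)"] by simp
  qed
next
  assume no: "\<not> (\<exists>s. \<forall>n::nat. s n \<in> S \<and> s (Suc n) < s n)"
  show "wfp_on S (<)"
  proof (rule ccontr)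
    assume "\<not> wfp_on S (<)"
    then have "\<exists>B. B \<subseteq> S \<and> B \<noteq> {} \<and> (\<forall>z\<in>B. \<exists>y. y < z \<and> y \<in> B)"
      unfolding wfp_on_iff_ex_minimal by simp
    then obtain B where B: "B \<subseteq> S" "B \<noteq> {}" "\<forall>z\<in>B. \<exists>y. y < z \<and> y \<in> B"
      by (elim exE conjE)
    have "\<exists>s. \<forall>n::nat. s n \<in> B \<and> s (Suc n) < s n"
    proof (rule dependent_nat_choice)
      show "\<exists>x. x \<in> B" using B(2) by auto
      show "\<exists>y. y \<in> B \<and> y < x" if "x \<in> B" for x using B(3) that by auto
    qed
    then show False using no B(1) by blast
  qed
qed

lemma wfp_on_less_incseq_subseq:
  fixes a :: "nat \<Rightarrow> 'a::linorder"
  assumes wf: "wfp_on S (<)" and a: "\<And>n. a n \<in> S"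
  shows "\<exists>r::nat \<Rightarrow> nat. strict_mono r \<and> incseq (\<lambda>n. a (r n))"
proof -
  obtain r where r: "strict_mono (r::nat \<Rightarrow> nat)" "monoseq (\<lambda>n. a (r n))"
    using seq_monosub[of a] by blast
  show ?thesis
  proof (cases "incseq (\<lambda>n. a (r n))")
    case True
    then show ?thesis using r by blast
  next
    case False
    then have dec: "decseq (\<lambda>n. a (r n))" using r(2) by (simp add: monoseq_iff)
    have "range (\<lambda>n. a (r n)) \<subseteq> S" "range (\<lambda>n. a (r n)) \<noteq> {}" using a by auto
    then obtain z where z: "z \<in> range (\<lambda>n. a (r n))" "\<And>y. y \<in> range (\<lambda>n. a (r n)) \<Longrightarrow> z \<le> y"
      using wfp_on_less_least[OF wf] by metis
    then obtain N where N: "z = a (r N)" by auto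
    have const: "a (r (N + n)) = z" for n
    proof (rule antisym)
      show "a (r (N + n)) \<le> z" using dec N by (simp add: decseq_def)
      show "z \<le> a (r (N + n))" by (rule z(2)) simp
    qed
    have "strict_mono (\<lambda>n. r (N + n))" using r(1) by (simp add: strict_mono_def)
    moreover have "incseq (\<lambda>n. a (r (N + n)))" by (simp add: const incseq_def)
    ultimately show ?thesis by blast
  qed
qed

lemma wfp_on_less_Un:
  fixes S T :: "'a::linorder set"
  assumes "wfp_on S (<)" "wfp_on T (<)"
  shows "wfp_on (S \<union> T) (<)"
  unfolding wfp_on_iff_ex_minimal
proof (intro allI impI)
  fix B assume B: "B \<subseteq> S \<union> T" "B \<noteq> {}"
  have S: "\<exists>z\<in>A. \<forall>y\<in>A. z \<le> y" if "A \<subseteq> S" "A \<noteq> {}" for A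
    using wfp_on_less_least[OF assms(1) that] by metis
  have T: "\<exists>z\<in>A. \<forall>y\<in>A. z \<le> y" if "A \<subseteq> T" "A \<noteq> {}" for A
    using wfp_on_less_least[OF assms(2) that] by metis
  have "\<exists>z\<in>B. \<forall>y\<in>B. z \<le> y"
  proof (cases "B \<inter> S = {} \<or> B \<inter> T = {}")
    case True
    then have "B \<subseteq> S \<or> B \<subseteq> T" using B(1) by blast
    then show ?thesis using S T B(2) by blast
  next
    case False
    then obtain x y where xy: "x \<in> B \<inter> S" "\<forall>z\<in>B \<inter> S. x \<le> z" "y \<in> B \<inter> T" "\<forall>z\<in>B \<inter> T. y \<le> z"
      using S[of "B \<inter> S"] T[of "B \<inter> T"] by auto
    have "min x y \<in> B" using xy by (simp add: min_def)
    moreover have "min x y \<le> z" if "z \<in> B" for z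
      using xy that B(1) by (auto simp: min_le_iff_disj)
    ultimately show ?thesis by blast
  qed
  then show "\<exists>z\<in>B. \<forall>y. y < z \<longrightarrow> y \<notin> B" by (meson not_le)
qed

lemma wfp_on_less_set_plus:
  fixes S T :: "'g::linordered_ab_group_add set"
  assumes S: "wfp_on S (<)" and T: "wfp_on T (<)"
  shows "wfp_on {a + b |a b. a \<in> S \<and> b \<in> T} (<)"
proof (rule ccontr)
  assume "\<not> ?thesis"
  then obtain s where s: "\<And>n::nat. s n \<in> {a + b |a b. a \<in> S \<and> b \<in> T}" "\<And>n. s (Suc n) < s n"
    unfolding wfp_on_less_iff_no_descending by blast
  have "\<forall>n. \<exists>p. s n = fst p + snd p \<and> fst p \<in> S \<and> snd p \<in> T" using s(1) by simp
  then obtain p where p: "\<forall>n. s n = fst (p n) + snd (p n) \<and> fst (p n) \<in> S \<and> snd (p n) \<in> T"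
    by (rule choice[THEN exE])
  define a b where "a n = fst (p n)" and "b n = snd (p n)" for n
  have ab: "s n = a n + b n" "a n \<in> S" "b n \<in> T" for n
    using p by (simp_all add: a_def b_def)
  obtain r where r: "strict_mono (r::nat \<Rightarrow> nat)" "incseq (\<lambda>n. a (r n))"
    using wfp_on_less_incseq_subseq[of S a, OF S ab(2)] by blast
  have "b (r (Suc n)) < b (r n)" for n
  proof (rule ccontr)
    assume "\<not> ?thesis"
    then have "s (r n) \<le> s (r (Suc n))"
      using incseq_SucD[OF r(2), of n] by (simp add: ab(1) add_mono)
    moreover have "s (r (Suc n)) < s (r n)"
    proof -
      have "r n < r (Suc n)" using r(1) by (simp add: strict_mono_less)
      then have "s (r (Suc n)) \<le> s (Suc (r n))"
        using lift_Suc_antimono_le[of s "Suc (r n)" "r (Suc n)"] s(2) by (simp add: less_imp_le)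
      then show ?thesis using s(2)[of "r n"] by simp
    qed
    ultimately show False by simp
  qed
  then have "\<forall>n. b (r n) \<in> T \<and> b (r (Suc n)) < b (r n)" using ab(3) by simp
  then have "\<exists>s. \<forall>n::nat. s n \<in> T \<and> s (Suc n) < s n"
    by (rule exI[of _ "\<lambda>n. b (r n)"])
  then show False using T unfolding wfp_on_less_iff_no_descending by (rule notE[rotated])
qed

lemma finite_pairs_with_sum:
  fixes S T :: "'g::linordered_ab_group_add set"
  assumes S: "wfp_on S (<)" and T: "wfp_on T (<)"
  shows "finite {(a, b). a \<in> S \<and> b \<in> T \<and> a + b = c}"
proof (rule ccontr)
  let ?P = "{(a, b). a \<in> S \<and> b \<in> T \<and> a + b = c}"
  assume "infinite ?P"
  then obtain p :: "nat \<Rightarrow> 'g \<times> 'g" where p: "inj p" "range p \<subseteq> ?P"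
    using infinite_countable_subset[of ?P] by auto
  define a b where "a n = fst (p n)" and "b n = snd (p n)" for n
  have ab: "a n \<in> S" "b n \<in> T" "b n = c - a n" for n
  proof -
    have "p n \<in> ?P" by (rule subsetD[OF p(2)]) simp
    then show "a n \<in> S" "b n \<in> T" "b n = c - a n"
      by (auto simp: a_def b_def)
  qed
  have "inj a"
  proof (rule injI)
    fix m n assume "a m = a n"
    then have "p m = p n" using ab(3) by (simp add: a_def b_def prod_eq_iff)
    then show "m = n" using p(1) by (simp add: inj_eq)
  qed
  obtain r where r: "strict_mono (r::nat \<Rightarrow> nat)" "incseq (\<lambda>n. a (r n))"
    using wfp_on_less_incseq_subseq[of S a, OF S ab(1)] by blast
  have "b (r (Suc n)) < b (r n)" for n
  proof -
    have "a (r n) \<le> a (r (Suc n))" using incseq_SucD[OF r(2)] by simp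
    moreover have "a (r n) \<noteq> a (r (Suc n))"
      using \<open>inj a\<close> r(1) by (simp add: inj_eq strict_mono_eq)
    ultimately show ?thesis by (simp add: ab(3))
  qed
  then have "\<forall>n. b (r n) \<in> T \<and> b (r (Suc n)) < b (r n)" using ab(2) by simp
  then have "\<exists>s. \<forall>n::nat. s n \<in> T \<and> s (Suc n) < s n"
    by (rule exI[of _ "\<lambda>n. b (r n)"])
  then show False using T unfolding wfp_on_less_iff_no_descending by (rule notE[rotated])
qed


section \<open>Hahn series\<close>

text \<open>The exponents are linearly ordered, so well-foundedness of \<open><\<close> on the support says that the
  support is well-ordered.\<close>

typedef (overloaded) ('g::linordered_ab_group_add, 'c::zero) hahn =
    "{f :: 'g \<Rightarrow> 'c. wfp_on {\<gamma>. f \<gamma> \<noteq> 0} (<)}"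
  morphisms hahn_coeff Abs_hahn
  by (rule exI[of _ "\<lambda>_. 0"]) (simp add: wfp_on_def)

setup_lifting type_definition_hahn

definition hahn_supp :: "('g::linordered_ab_group_add, 'c::zero) hahn \<Rightarrow> 'g set" where
  "hahn_supp f = {\<gamma>. hahn_coeff f \<gamma> \<noteq> 0}"

lemma hahn_supp_wf: "wfp_on (hahn_supp f) (<)"
  using hahn_coeff[of f] by (simp add: hahn_supp_def)

lemma hahn_eqI: "(\<And>\<gamma>. hahn_coeff f \<gamma> = hahn_coeff g \<gamma>) \<Longrightarrow> f = g"
  by (simp add: hahn_coeff_inject[symmetric] fun_eq_iff)

definition conv_pairs :: "'g::linordered_ab_group_add set \<Rightarrow> 'g set \<Rightarrow> 'g \<Rightarrow> ('g \<times> 'g) set" where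
  "conv_pairs S T \<gamma> = {(a, b). a \<in> S \<and> b \<in> T \<and> a + b = \<gamma>}"

instantiation hahn :: (linordered_ab_group_add, comm_ring_1) comm_ring_1
begin

lift_definition zero_hahn :: "('a, 'b) hahn" is "\<lambda>_. 0"
  by (simp add: wfp_on_def)

lift_definition one_hahn :: "('a, 'b) hahn" is "\<lambda>\<gamma>. if \<gamma> = 0 then 1 else 0"
  by (auto simp: wfp_on_iff_ex_minimal)

lift_definition plus_hahn :: "('a, 'b) hahn \<Rightarrow> ('a, 'b) hahn \<Rightarrow> ('a, 'b) hahn"
  is "\<lambda>f g \<gamma>. f \<gamma> + g \<gamma>"
  by (rule wfp_on_subset[OF wfp_on_less_Un], assumption, assumption) auto

lift_definition uminus_hahn :: "('a, 'b) hahn \<Rightarrow> ('a, 'b) hahn" is "\<lambda>f \<gamma>. - f \<gamma>"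
  by simp

lift_definition minus_hahn :: "('a, 'b) hahn \<Rightarrow> ('a, 'b) hahn \<Rightarrow> ('a, 'b) hahn"
  is "\<lambda>f g \<gamma>. f \<gamma> - g \<gamma>"
  by (rule wfp_on_subset[OF wfp_on_less_Un], assumption, assumption) auto

text \<open>The sums below are over finite sets, see \<open>finite_pairs_with_sum\<close>.\<close>

lift_definition times_hahn :: "('a, 'b) hahn \<Rightarrow> ('a, 'b) hahn \<Rightarrow> ('a, 'b) hahn"
  is "\<lambda>f g \<gamma>. \<Sum>(a, b)\<in>conv_pairs {a. f a \<noteq> 0} {b. g b \<noteq> 0} \<gamma>. f a * g b"
proof -
  fix f g :: "'a \<Rightarrow> 'b"
  assume f: "wfp_on {a. f a \<noteq> 0} (<)" and g: "wfp_on {a. g a \<noteq> 0} (<)"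
  have "\<gamma> \<in> {a + b |a b. a \<in> {a. f a \<noteq> 0} \<and> b \<in> {b. g b \<noteq> 0}}"
    if "(\<Sum>(a, b)\<in>conv_pairs {a. f a \<noteq> 0} {b. g b \<noteq> 0} \<gamma>. f a * g b) \<noteq> 0" for \<gamma>
  proof -
    have "conv_pairs {a. f a \<noteq> 0} {b. g b \<noteq> 0} \<gamma> \<noteq> {}" using that by (metis sum.empty)
    then show ?thesis by (auto simp: conv_pairs_def)
  qed
  then have "{\<gamma>. (\<Sum>(a, b)\<in>conv_pairs {a. f a \<noteq> 0} {b. g b \<noteq> 0} \<gamma>. f a * g b) \<noteq> 0}
      \<subseteq> {a + b |a b. a \<in> {a. f a \<noteq> 0} \<and> b \<in> {b. g b \<noteq> 0}}"
    by (intro subsetI) (simp only: mem_Collect_eq)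
  then show "wfp_on {\<gamma>. (\<Sum>(a, b)\<in>conv_pairs {a. f a \<noteq> 0} {b. g b \<noteq> 0} \<gamma>. f a * g b) \<noteq> 0} (<)"
    by (rule wfp_on_subset[OF wfp_on_less_set_plus[OF f g]])
qed

lemma coeff_times_superset:
  fixes f g :: "('a, 'b) hahn"
  assumes "wfp_on S (<)" "wfp_on T (<)" "hahn_supp f \<subseteq> S" "hahn_supp g \<subseteq> T"
  shows "hahn_coeff (f * g) \<gamma> = (\<Sum>(a, b)\<in>conv_pairs S T \<gamma>. hahn_coeff f a * hahn_coeff g b)"
  unfolding times_hahn.rep_eq
proof (rule sum.mono_neutral_left)
  show "finite (conv_pairs S T \<gamma>)"
    using finite_pairs_with_sum[OF assms(1,2)] by (simp add: conv_pairs_def)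
qed (use assms(3,4) in \<open>auto simp: conv_pairs_def hahn_supp_def\<close>)

lemma coeff_times:
  fixes f g :: "('a, 'b) hahn"
  shows "hahn_coeff (f * g) \<gamma> =
    (\<Sum>(a, b)\<in>conv_pairs (hahn_supp f) (hahn_supp g) \<gamma>. hahn_coeff f a * hahn_coeff g b)"
  by (rule coeff_times_superset) (simp_all add: hahn_supp_wf)

instance
proof
  fix f g h :: "('a, 'b) hahn"
  show "f + g + h = f + (g + h)" by transfer (simp add: add.assoc)
  show "f + g = g + f" by transfer (simp add: add.commute)
  show "0 + f = f" by transfer simp
  show "- f + f = 0" by transfer simp
  show "f - g = f + - g" by transfer simp
  show "(0 :: ('a, 'b) hahn) \<noteq> 1" by transfer (metis zero_neq_one)
  show "f * g = g * f"
  proof (rule hahn_eqI)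
    fix \<gamma>
    show "hahn_coeff (f * g) \<gamma> = hahn_coeff (g * f) \<gamma>"
      unfolding coeff_times
      by (rule sum.reindex_bij_witness[of _ prod.swap prod.swap])
        (auto simp: conv_pairs_def add.commute mult.commute)
  qed
  show "1 * f = f"
  proof (rule hahn_eqI)
    fix \<gamma>
    have wf0: "wfp_on {0 :: 'a} (<)" by (auto simp: wfp_on_iff_ex_minimal)
    have wf1: "wfp_on (insert \<gamma> (hahn_supp f)) (<)"
      using wfp_on_less_Un[OF _ hahn_supp_wf, of "{\<gamma>}" f] by (auto simp: wfp_on_iff_ex_minimal)
    have "conv_pairs {0} (insert \<gamma> (hahn_supp f)) \<gamma> = {(0, \<gamma>)}" by (auto simp: conv_pairs_def)
    then show "hahn_coeff (1 * f) \<gamma> = hahn_coeff f \<gamma>"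
      by (subst coeff_times_superset[OF wf0 wf1]) (auto simp: hahn_supp_def one_hahn.rep_eq)
  qed
  show "(f + g) * h = f * h + g * h"
  proof (rule hahn_eqI)
    fix \<gamma>
    let ?S = "hahn_supp f \<union> hahn_supp g"
    have wf: "wfp_on ?S (<)" by (rule wfp_on_less_Un[OF hahn_supp_wf hahn_supp_wf])
    have sub: "hahn_supp (f + g) \<subseteq> ?S" by (auto simp: hahn_supp_def plus_hahn.rep_eq)
    note * = coeff_times_superset[OF wf hahn_supp_wf _ order_refl, of _ h \<gamma>]
    show "hahn_coeff ((f + g) * h) \<gamma> = hahn_coeff (f * h + g * h) \<gamma>"
      by (simp add: plus_hahn.rep_eq * sub)
        (simp add: plus_hahn.rep_eq distrib_right sum.distrib[symmetric] case_prod_unfold)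
  qed
  show "f * g * h = f * (g * h)"
  proof (rule hahn_eqI)
    fix \<gamma>
    let ?c = "\<lambda>(a, b, c). hahn_coeff f a * (hahn_coeff g b * hahn_coeff h c)"
    let ?F = "hahn_supp f" and ?G = "hahn_supp g" and ?H = "hahn_supp h"
    let ?FG = "{a + b |a b. a \<in> ?F \<and> b \<in> ?G}" and ?GH = "{a + b |a b. a \<in> ?G \<and> b \<in> ?H}"
    let ?T = "{(a, b, c). a \<in> ?F \<and> b \<in> ?G \<and> c \<in> ?H \<and> a + b + c = \<gamma>}"
    note fin = finite_pairs_with_sum[folded conv_pairs_def]
    have sub: "hahn_supp (u * v) \<subseteq> {a + b |a b. a \<in> hahn_supp u \<and> b \<in> hahn_supp v}"
      for u v :: "('a, 'b) hahn"
    proof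
      fix x assume "x \<in> hahn_supp (u * v)"
      then have "conv_pairs (hahn_supp u) (hahn_supp v) x \<noteq> {}"
        by (metis (mono_tags, lifting) coeff_times hahn_supp_def mem_Collect_eq sum.empty)
      then show "x \<in> {a + b |a b. a \<in> hahn_supp u \<and> b \<in> hahn_supp v}"
        by (auto simp: conv_pairs_def)
    qed
    have wfFG: "wfp_on ?FG (<)" and wfGH: "wfp_on ?GH (<)"
      by (rule wfp_on_less_set_plus[OF hahn_supp_wf hahn_supp_wf])+
    have "hahn_coeff (f * g * h) \<gamma> =
        (\<Sum>p\<in>conv_pairs ?FG ?H \<gamma>. \<Sum>q\<in>conv_pairs ?F ?G (fst p).
          hahn_coeff f (fst q) * hahn_coeff g (snd q) * hahn_coeff h (snd p))"
      by (subst coeff_times_superset[OF wfFG hahn_supp_wf sub order_refl])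
        (simp add: coeff_times sum_distrib_right case_prod_unfold)
    also have "\<dots> = (\<Sum>(p, q)\<in>(SIGMA p:conv_pairs ?FG ?H \<gamma>. conv_pairs ?F ?G (fst p)).
          hahn_coeff f (fst q) * hahn_coeff g (snd q) * hahn_coeff h (snd p))"
      by (rule sum.Sigma) (auto intro!: fin hahn_supp_wf wfFG)
    also have "\<dots> = sum ?c ?T"
      by (rule sum.reindex_bij_witness[of _ "\<lambda>(a, b, c). ((a + b, c), (a, b))"
            "\<lambda>((d, c), (a, b)). (a, b, c)"])
        (auto simp: conv_pairs_def mult.assoc)
    also have "\<dots> = (\<Sum>(p, q)\<in>(SIGMA p:conv_pairs ?F ?GH \<gamma>. conv_pairs ?G ?H (snd p)).
          hahn_coeff f (fst p) * (hahn_coeff g (fst q) * hahn_coeff h (snd q)))"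
      by (rule sum.reindex_bij_witness[of _ "\<lambda>((a, d), (b, c)). (a, b, c)"
            "\<lambda>(a, b, c). ((a, b + c), (b, c))"])
        (auto simp: conv_pairs_def add.assoc)
    also have "\<dots> = (\<Sum>p\<in>conv_pairs ?F ?GH \<gamma>. \<Sum>q\<in>conv_pairs ?G ?H (snd p).
          hahn_coeff f (fst p) * (hahn_coeff g (fst q) * hahn_coeff h (snd q)))"
      by (rule sum.Sigma[symmetric]) (auto intro!: fin hahn_supp_wf wfGH)
    also have "\<dots> = hahn_coeff (f * (g * h)) \<gamma>"
      by (subst coeff_times_superset[OF hahn_supp_wf wfGH order_refl sub])
        (simp add: coeff_times sum_distrib_left case_prod_unfold)
    finally show "hahn_coeff (f * g * h) \<gamma> = hahn_coeff (f * (g * h)) \<gamma>" .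
  qed
qed

end

definition hahn_val_ring :: "('g::linordered_ab_group_add, 'c::zero) hahn set" where
  "hahn_val_ring = {f. hahn_supp f \<subseteq> {\<gamma>. 0 \<le> \<gamma>}}"

text \<open>The derivation \<open>t d/dt\<close>. The parameter \<open>\<iota>\<close> is the embedding of the exponent group in the
  coefficient field, i.e. \<open>of_int\<close> for integer and \<open>of_rat\<close> for rational exponents.\<close>

lift_definition hahn_tddt ::
    "('g \<Rightarrow> 'c) \<Rightarrow> ('g::linordered_ab_group_add, 'c::comm_ring_1) hahn \<Rightarrow> ('g, 'c) hahn"
  is "\<lambda>\<iota> f \<gamma>. \<iota> \<gamma> * f \<gamma>"
  by (erule wfp_on_subset) auto

lemma hahn_tddt_add: "hahn_tddt \<iota> (f + g) = hahn_tddt \<iota> f + hahn_tddt \<iota> g"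
  by transfer (simp add: distrib_left)

lemma hahn_tddt_mult:
  assumes "\<And>a b. \<iota> (a + b) = \<iota> a + \<iota> b"
  shows "hahn_tddt \<iota> (f * g) = hahn_tddt \<iota> f * g + f * hahn_tddt \<iota> g"
proof (rule hahn_eqI)
  fix \<gamma>
  have sub: "hahn_supp (hahn_tddt \<iota> u) \<subseteq> hahn_supp u" for u
    by (auto simp: hahn_supp_def hahn_tddt.rep_eq)
  have l: "hahn_coeff (hahn_tddt \<iota> f * g) \<gamma> = (\<Sum>(a, b)\<in>conv_pairs (hahn_supp f) (hahn_supp g) \<gamma>.
      \<iota> a * hahn_coeff f a * hahn_coeff g b)"
    by (simp add: coeff_times_superset[OF hahn_supp_wf hahn_supp_wf sub order_refl] hahn_tddt.rep_eq)
  have r: "hahn_coeff (f * hahn_tddt \<iota> g) \<gamma> = (\<Sum>(a, b)\<in>conv_pairs (hahn_supp f) (hahn_supp g) \<gamma>.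
      hahn_coeff f a * (\<iota> b * hahn_coeff g b))"
    by (simp add: coeff_times_superset[OF hahn_supp_wf hahn_supp_wf order_refl sub] hahn_tddt.rep_eq)
  show "hahn_coeff (hahn_tddt \<iota> (f * g)) \<gamma> = hahn_coeff (hahn_tddt \<iota> f * g + f * hahn_tddt \<iota> g) \<gamma>"
    unfolding plus_hahn.rep_eq l r hahn_tddt.rep_eq[of \<iota> "f * g"] coeff_times[of f g]
      sum_distrib_left sum.distrib[symmetric]
    by (rule sum.cong) (auto simp: conv_pairs_def assms algebra_simps)
qed


section \<open>First-order formulas in the language \<open>{0, 1, -, +, \<cdot>, \<partial>, \<O>}\<close>\<close>

datatype vdf_term =
    TVar nat
  | TZero
  | TOne
  | TMinus vdf_term
  | TPlus vdf_term vdf_term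
  | TTimes vdf_term vdf_term
  | TDer vdf_term

datatype vdf_form =
    FEq vdf_term vdf_term
  | FValRing vdf_term
  | FNot vdf_form
  | FAnd vdf_form vdf_form
  | FEx nat vdf_form

fun term_vars :: "vdf_term \<Rightarrow> nat set" where
  "term_vars (TVar i) = {i}"
| "term_vars TZero = {}"
| "term_vars TOne = {}"
| "term_vars (TMinus s) = term_vars s"
| "term_vars (TPlus s t) = term_vars s \<union> term_vars t"
| "term_vars (TTimes s t) = term_vars s \<union> term_vars t"
| "term_vars (TDer s) = term_vars s"

fun free_vars :: "vdf_form \<Rightarrow> nat set" where
  "free_vars (FEq s t) = term_vars s \<union> term_vars t"
| "free_vars (FValRing s) = term_vars s"
| "free_vars (FNot \<phi>) = free_vars \<phi>"
| "free_vars (FAnd \<phi> \<psi>) = free_vars \<phi> \<union> free_vars \<psi>"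
| "free_vars (FEx i \<phi>) = free_vars \<phi> - {i}"

definition sentence :: "vdf_form \<Rightarrow> bool" where
  "sentence \<phi> \<longleftrightarrow> free_vars \<phi> = {}"

text \<open>The structure is given by the ring operations of the type \<open>'a\<close>, a derivation \<open>d\<close> and a
  valuation ring \<open>V\<close>; its domain is all of \<open>'a\<close>.\<close>

fun term_val :: "('a::comm_ring_1 \<Rightarrow> 'a) \<Rightarrow> (nat \<Rightarrow> 'a) \<Rightarrow> vdf_term \<Rightarrow> 'a" where
  "term_val d e (TVar i) = e i"
| "term_val d e TZero = 0"
| "term_val d e TOne = 1"
| "term_val d e (TMinus s) = - term_val d e s"
| "term_val d e (TPlus s t) = term_val d e s + term_val d e t"
| "term_val d e (TTimes s t) = term_val d e s * term_val d e t"
| "term_val d e (TDer s) = d (term_val d e s)"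

fun sat :: "('a::comm_ring_1 \<Rightarrow> 'a) \<Rightarrow> 'a set \<Rightarrow> (nat \<Rightarrow> 'a) \<Rightarrow> vdf_form \<Rightarrow> bool" where
  "sat d V e (FEq s t) \<longleftrightarrow> term_val d e s = term_val d e t"
| "sat d V e (FValRing s) \<longleftrightarrow> term_val d e s \<in> V"
| "sat d V e (FNot \<phi>) \<longleftrightarrow> \<not> sat d V e \<phi>"
| "sat d V e (FAnd \<phi> \<psi>) \<longleftrightarrow> sat d V e \<phi> \<and> sat d V e \<psi>"
| "sat d V e (FEx i \<phi>) \<longleftrightarrow> (\<exists>x. sat d V (e(i := x)) \<phi>)"

definition vdf_theory :: "('a::comm_ring_1 \<Rightarrow> 'a) \<Rightarrow> 'a set \<Rightarrow> vdf_form set" where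
  "vdf_theory d V = {\<phi>. sentence \<phi> \<and> (\<forall>e. sat d V e \<phi>)}"


section \<open>Decidability\<close>

fun term_code :: "vdf_term \<Rightarrow> nat" where
  "term_code (TVar i) = prod_encode (0, i)"
| "term_code TZero = prod_encode (1, 0)"
| "term_code TOne = prod_encode (2, 0)"
| "term_code (TMinus s) = prod_encode (3, term_code s)"
| "term_code (TPlus s t) = prod_encode (4, prod_encode (term_code s, term_code t))"
| "term_code (TTimes s t) = prod_encode (5, prod_encode (term_code s, term_code t))"
| "term_code (TDer s) = prod_encode (6, term_code s)"

fun form_code :: "vdf_form \<Rightarrow> nat" where
  "form_code (FEq s t) = prod_encode (0, prod_encode (term_code s, term_code t))"
| "form_code (FValRing s) = prod_encode (1, term_code s)"
| "form_code (FNot \<phi>) = prod_encode (2, form_code \<phi>)"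
| "form_code (FAnd \<phi> \<psi>) = prod_encode (3, prod_encode (form_code \<phi>, form_code \<psi>))"
| "form_code (FEx i \<phi>) = prod_encode (4, prod_encode (i, form_code \<phi>))"

lemma term_code_inject: "term_code s = term_code t \<longleftrightarrow> s = t"
proof (induction s arbitrary: t)
  case (TVar i)
  then show ?case by (cases t) (simp_all add: prod_encode_eq)
next
  case TZero
  then show ?case by (cases t) (simp_all add: prod_encode_eq)
next
  case TOne
  then show ?case by (cases t) (simp_all add: prod_encode_eq)
next
  case (TMinus u)
  then show ?case by (cases t) (simp_all add: prod_encode_eq)
next
  case (TPlus u v)
  then show ?case by (cases t) (simp_all add: prod_encode_eq)
next
  case (TTimes u v)
  then show ?case by (cases t) (simp_all add: prod_encode_eq)
next
  case (TDer u)
  then show ?case by (cases t) (simp_all add: prod_encode_eq)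
qed

lemma form_code_inject: "form_code \<phi> = form_code \<psi> \<longleftrightarrow> \<phi> = \<psi>"
proof (induction \<phi> arbitrary: \<psi>)
  case (FEq s t)
  then show ?case by (cases \<psi>) (simp_all add: prod_encode_eq term_code_inject)
next
  case (FValRing s)
  then show ?case by (cases \<psi>) (simp_all add: prod_encode_eq term_code_inject)
next
  case (FNot \<chi>)
  then show ?case by (cases \<psi>) (simp_all add: prod_encode_eq term_code_inject)
next
  case (FAnd \<chi> \<xi>)
  then show ?case by (cases \<psi>) (simp_all add: prod_encode_eq term_code_inject)
next
  case (FEx i \<chi>)
  then show ?case by (cases \<psi>) (simp_all add: prod_encode_eq term_code_inject)
qed

text \<open>Partial recursive functions: programs, and the graph \<open>computes p xs y\<close> of the partial
  function \<open>p\<close>, relating an argument list to the value.\<close>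

datatype recf =
    RZero
  | RSucc
  | RProj nat
  | RComp recf "recf list"
  | RPrim recf recf
  | RMin recf

inductive computes :: "recf \<Rightarrow> nat list \<Rightarrow> nat \<Rightarrow> bool" where
  "computes RZero xs 0"
| "computes RSucc [x] (Suc x)"
| "i < length xs \<Longrightarrow> computes (RProj i) xs (xs ! i)"
| "list_all2 (\<lambda>g y. computes g xs y) gs ys \<Longrightarrow> computes f ys z \<Longrightarrow> computes (RComp f gs) xs z"
| "computes f xs y \<Longrightarrow> computes (RPrim f g) (0 # xs) y"
| "computes (RPrim f g) (n # xs) y \<Longrightarrow> computes g (n # y # xs) z \<Longrightarrow>
    computes (RPrim f g) (Suc n # xs) z"
| "computes f (n # xs) 0 \<Longrightarrow> (\<And>m. m < n \<Longrightarrow> \<exists>y. computes f (m # xs) (Suc y)) \<Longrightarrow>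
    computes (RMin f) xs n"

inductive_cases computes_RZeroE: "computes RZero xs z"
inductive_cases computes_RSuccE: "computes RSucc xs z"
inductive_cases computes_RProjE: "computes (RProj i) xs z"
inductive_cases computes_RCompE: "computes (RComp f gs) xs z"
inductive_cases computes_RPrim_zeroE: "computes (RPrim f g) (0 # xs) z"
inductive_cases computes_RPrim_SucE: "computes (RPrim f g) (Suc n # xs) z"
inductive_cases computes_RMinE: "computes (RMin f) xs z"

lemma computes_functional: "computes p xs y \<Longrightarrow> computes p xs z \<Longrightarrow> y = z"
proof (induction p xs y arbitrary: z rule: computes.induct)
  case 1
  then show ?case by (elim computes_RZeroE) simp
next
  case 2
  then show ?case by (elim computes_RSuccE) simp
next
  case 3
  from 3(2) show ?case by (elim computes_RProjE) simp
next
  case (4 xs gs ys f y)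
  from 4(4) obtain ys' where ys': "list_all2 (\<lambda>g y. computes g xs y) gs ys'" "computes f ys' z"
    by (rule computes_RCompE)
  have "ys = ys'"
  proof (rule nth_equalityI)
    show "length ys = length ys'"
      using list_all2_lengthD[OF 4(1)] list_all2_lengthD[OF ys'(1)] by simp
    show "ys ! i = ys' ! i" if "i < length ys" for i
    proof -
      have i: "i < length gs" using that list_all2_lengthD[OF 4(1)] by simp
      show ?thesis using list_all2_nthD[OF 4(1) i] list_all2_nthD[OF ys'(1) i] by simp
    qed
  qed
  then show ?case using 4 ys'(2) by simp
next
  case 5
  from 5(3) show ?case by (rule computes_RPrim_zeroE) (rule 5(2))
next
  case (6 f g n xs y z')
  from 6(5) obtain y' where y': "computes (RPrim f g) (n # xs) y'" "computes g (n # y' # xs) z"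
    by (rule computes_RPrim_SucE)
  have "y = y'" by (rule 6(3)[OF y'(1)])
  then show ?case using 6(4) y'(2) by simp
next
  case (7 f n xs)
  from 7(4) have z: "computes f (z # xs) 0" "\<And>m. m < z \<Longrightarrow> \<exists>y. computes f (m # xs) (Suc y)"
    by (rule computes_RMinE, simp)+
  have "\<not> z < n"
  proof
    assume "z < n"
    then obtain y where "\<forall>x. computes f (z # xs) x \<longrightarrow> Suc y = x" using 7(3) by auto
    then show False using z(1) by auto
  qed
  moreover have "\<not> n < z"
  proof
    assume "n < z"
    then obtain y where "computes f (n # xs) (Suc y)" using z(2) by auto
    then show False using 7(2) by auto
  qed
  ultimately show ?case by simp
qed

definition recursive_set :: "nat set \<Rightarrow> bool" where
  "recursive_set A \<longleftrightarrow> (\<exists>p. \<forall>n. computes p [n] (if n \<in> A then 1 else 0))"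

definition decidable :: "vdf_form set \<Rightarrow> bool" where
  "decidable T \<longleftrightarrow> recursive_set (form_code ` T)"

end

theory Submission
  imports Defs
begin

text \<open>For a constant \<open>x\<close> and a series \<open>f\<close>, the equation \<open>\<partial>g = x g + f\<close> reads
  \<open>(\<gamma> - x) g\<^sub>\<gamma> = f\<^sub>\<gamma>\<close> on coefficients, so it is unsolvable exactly when \<open>x\<close> is an
  exponent occurring in \<open>f\<close>. Membership of an exponent in a support is therefore first-order
  definable. As every set of natural numbers is a support, the set of natural numbers is definable
  as the smallest support that contains 0 and is closed under successor, and first-order formulas
  over the Hahn field can quantify over all sets of natural numbers. Hence the graph of every
  partial recursive function is definable, and Tarski's diagonal argument applies.\<close>

section \<open>Semantic definability\<close>

fun rename_term :: "(nat \<Rightarrow> nat) \<Rightarrow> vdf_term \<Rightarrow> vdf_term" where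
  "rename_term \<rho> (TVar i) = TVar (\<rho> i)"
| "rename_term \<rho> TZero = TZero"
| "rename_term \<rho> TOne = TOne"
| "rename_term \<rho> (TMinus s) = TMinus (rename_term \<rho> s)"
| "rename_term \<rho> (TPlus s t) = TPlus (rename_term \<rho> s) (rename_term \<rho> t)"
| "rename_term \<rho> (TTimes s t) = TTimes (rename_term \<rho> s) (rename_term \<rho> t)"
| "rename_term \<rho> (TDer s) = TDer (rename_term \<rho> s)"

text \<open>A bound variable is moved above all renamed free variables of the body, so nothing is
  captured even when \<open>\<rho>\<close> is not injective, as for the maps \<open>n - 1\<close>
  and constant 0 used later. \<open>insert 0\<close> keeps \<open>Max\<close> meaningful when the
  body is closed.\<close>

fun rename_form :: "(nat \<Rightarrow> nat) \<Rightarrow> vdf_form \<Rightarrow> vdf_form" where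
  "rename_form \<rho> (FEq s t) = FEq (rename_term \<rho> s) (rename_term \<rho> t)"
| "rename_form \<rho> (FValRing s) = FValRing (rename_term \<rho> s)"
| "rename_form \<rho> (FNot \<phi>) = FNot (rename_form \<rho> \<phi>)"
| "rename_form \<rho> (FAnd \<phi> \<psi>) = FAnd (rename_form \<rho> \<phi>) (rename_form \<rho> \<psi>)"
| "rename_form \<rho> (FEx i \<phi>) =
    (let m = Suc (Max (insert 0 (\<rho> ` free_vars \<phi>))) in FEx m (rename_form (\<rho>(i := m)) \<phi>))"

lemma finite_term_vars: "finite (term_vars t)"
  by (induction t) auto

lemma finite_free_vars: "finite (free_vars \<phi>)"
  by (induction \<phi>) (auto simp: finite_term_vars)

lemma term_val_cong: "(\<And>i. i \<in> term_vars t \<Longrightarrow> e i = e' i) \<Longrightarrow> term_val d e t = term_val d e' t"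
proof (induction t)
  case (TPlus s t)
  then show ?case by (metis Un_iff term_val.simps(5) term_vars.simps(5))
next
  case (TTimes s t)
  then show ?case by (metis Un_iff term_val.simps(6) term_vars.simps(6))
qed auto

lemma sat_cong: "(\<And>i. i \<in> free_vars \<phi> \<Longrightarrow> e i = e' i) \<Longrightarrow> sat d V e \<phi> \<longleftrightarrow> sat d V e' \<phi>"
proof (induction \<phi> arbitrary: e e')
  case (FEq s t)
  then show ?case by (metis Un_iff free_vars.simps(1) sat.simps(1) term_val_cong)
next
  case (FValRing s)
  then show ?case by (metis free_vars.simps(2) sat.simps(2) term_val_cong)
next
  case (FNot \<phi>)
  then show ?case by (metis free_vars.simps(3) sat.simps(3))
next
  case (FAnd \<phi> \<psi>)
  then show ?case by (metis Un_iff free_vars.simps(4) sat.simps(4))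
next
  case (FEx i \<phi>)
  have "sat d V (e(i := x)) \<phi> \<longleftrightarrow> sat d V (e'(i := x)) \<phi>" for x
    by (rule FEx.IH) (use FEx.prems in auto)
  then show ?case by simp
qed

lemma term_val_rename: "term_val d e (rename_term \<rho> t) = term_val d (\<lambda>i. e (\<rho> i)) t"
  by (induction t) auto

lemma sat_rename: "sat d V e (rename_form \<rho> \<phi>) \<longleftrightarrow> sat d V (\<lambda>i. e (\<rho> i)) \<phi>"
proof (induction \<phi> arbitrary: e \<rho>)
  case (FEx i \<phi>)
  define m where "m = Suc (Max (insert 0 (\<rho> ` free_vars \<phi>)))"
  have fresh: "\<rho> j \<noteq> m" if "j \<in> free_vars \<phi>" for j
  proof -
    have "\<rho> j \<le> Max (insert 0 (\<rho> ` free_vars \<phi>))"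
      using that by (intro Max_ge) (auto simp: finite_free_vars)
    then show ?thesis by (simp add: m_def)
  qed
  have "sat d V (\<lambda>j. (e(m := x)) ((\<rho>(i := m)) j)) \<phi> \<longleftrightarrow> sat d V ((\<lambda>j. e (\<rho> j))(i := x)) \<phi>" for x
    by (rule sat_cong) (use fresh in auto)
  then show ?case by (simp only: rename_form.simps Let_def m_def[symmetric] sat.simps FEx.IH)
qed (auto simp: term_val_rename)

lemma term_vars_rename: "term_vars (rename_term \<rho> t) = \<rho> ` term_vars t"
  by (induction t) auto

lemma free_vars_rename: "free_vars (rename_form \<rho> \<phi>) \<subseteq> \<rho> ` free_vars \<phi>"
proof (induction \<phi> arbitrary: \<rho>)
  case (FEx i \<phi>)
  define m where "m = Suc (Max (insert 0 (\<rho> ` free_vars \<phi>)))"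
  have "free_vars (rename_form (\<rho>(i := m)) \<phi>) \<subseteq> (\<rho>(i := m)) ` free_vars \<phi>" by (rule FEx.IH)
  then show ?case by (auto simp: Let_def m_def[symmetric])
qed (fastforce simp: term_vars_rename)+

section \<open>Definable predicates and their closure properties\<close>

definition term_definable :: "('a::comm_ring_1 \<Rightarrow> 'a) \<Rightarrow> ((nat \<Rightarrow> 'a) \<Rightarrow> 'a) \<Rightarrow> bool" where
  "term_definable d T \<longleftrightarrow> (\<exists>t. \<forall>e. term_val d e t = T e)"

text \<open>One list \<open>ts\<close> serves all environments, so the length of \<open>Ts e\<close>
  does not depend on \<open>e\<close>. This permits case distinctions on the argument list of a
  program.\<close>

definition terms_definable :: "('a::comm_ring_1 \<Rightarrow> 'a) \<Rightarrow> ((nat \<Rightarrow> 'a) \<Rightarrow> 'a list) \<Rightarrow> bool" where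
  "terms_definable d Ts \<longleftrightarrow> (\<exists>ts. \<forall>e. map (term_val d e) ts = Ts e)"

definition definable ::
    "('a::comm_ring_1 \<Rightarrow> 'a) \<Rightarrow> 'a set \<Rightarrow> ((nat \<Rightarrow> 'a) \<Rightarrow> bool) \<Rightarrow> bool" where
  "definable d V P \<longleftrightarrow> (\<exists>\<phi>. \<forall>e. sat d V e \<phi> \<longleftrightarrow> P e)"

lemma term_definable_var: "term_definable d (\<lambda>e. e i)"
  unfolding term_definable_def by (rule exI[of _ "TVar i"]) simp

lemma term_definable_zero: "term_definable d (\<lambda>e. 0)"
  unfolding term_definable_def by (rule exI[of _ TZero]) simp

lemma term_definable_one: "term_definable d (\<lambda>e. 1)"
  unfolding term_definable_def by (rule exI[of _ TOne]) simp

lemma term_definable_add: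
  "term_definable d S \<Longrightarrow> term_definable d T \<Longrightarrow> term_definable d (\<lambda>e. S e + T e)"
  unfolding term_definable_def by (metis term_val.simps(5))

lemma term_definable_mult:
  "term_definable d S \<Longrightarrow> term_definable d T \<Longrightarrow> term_definable d (\<lambda>e. S e * T e)"
  unfolding term_definable_def by (metis term_val.simps(6))

lemma term_definable_der: "term_definable d T \<Longrightarrow> term_definable d (\<lambda>e. d (T e))"
  unfolding term_definable_def by (metis term_val.simps(7))

lemma term_definable_rename: "term_definable d T \<Longrightarrow> term_definable d (\<lambda>e. T (\<lambda>n. e (\<rho> n)))"
  unfolding term_definable_def by (metis term_val_rename)

lemma terms_definable_Nil: "terms_definable d (\<lambda>e. [])"
  unfolding terms_definable_def by (rule exI[of _ "[]"]) simp

lemma terms_definable_Cons: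
  "term_definable d T \<Longrightarrow> terms_definable d Ts \<Longrightarrow> terms_definable d (\<lambda>e. T e # Ts e)"
  unfolding term_definable_def terms_definable_def by (metis list.simps(9))

lemma terms_definable_append:
  "terms_definable d Ss \<Longrightarrow> terms_definable d Ts \<Longrightarrow> terms_definable d (\<lambda>e. Ss e @ Ts e)"
  unfolding terms_definable_def by (metis map_append)

lemma terms_definable_rename:
  assumes "terms_definable d Ts"
  shows "terms_definable d (\<lambda>e. Ts (\<lambda>n. e (\<rho> n)))"
proof -
  obtain ts where ts: "\<And>e. map (term_val d e) ts = Ts e"
    using assms unfolding terms_definable_def by metis
  have "map (term_val d e) (map (rename_term \<rho>) ts) = Ts (\<lambda>n. e (\<rho> n))" for e
    unfolding ts[symmetric] by (simp add: term_val_rename)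
  then show ?thesis unfolding terms_definable_def by blast
qed

lemma terms_definable_cases:
  assumes "terms_definable d Ts"
  obtains "Ts = (\<lambda>e. [])"
  | S Ss where "Ts = (\<lambda>e. S e # Ss e)" "term_definable d S" "terms_definable d Ss"
proof -
  obtain ts where ts: "\<And>e. map (term_val d e) ts = Ts e"
    using assms unfolding terms_definable_def by metis
  show thesis
  proof (cases ts)
    case Nil
    then have "Ts = (\<lambda>e. [])" using ts by (metis list.simps(8))
    then show thesis by (rule that(1))
  next
    case (Cons s ss)
    show thesis
    proof (rule that(2))
      show "Ts = (\<lambda>e. term_val d e s # map (term_val d e) ss)"
        using ts Cons by (metis list.simps(9))
    qed (auto simp: term_definable_def terms_definable_def)
  qed
qed

lemma definable_eq:
  "term_definable d S \<Longrightarrow> term_definable d T \<Longrightarrow> definable d V (\<lambda>e. S e = T e)"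
  unfolding definable_def term_definable_def by (metis sat.simps(1))

lemma definable_not: "definable d V P \<Longrightarrow> definable d V (\<lambda>e. \<not> P e)"
  unfolding definable_def by (metis sat.simps(3))

lemma definable_conj:
  "definable d V P \<Longrightarrow> definable d V Q \<Longrightarrow> definable d V (\<lambda>e. P e \<and> Q e)"
  unfolding definable_def by (metis sat.simps(4))

lemma definable_imp:
  assumes "definable d V P" "definable d V Q"
  shows "definable d V (\<lambda>e. P e \<longrightarrow> Q e)"
  using definable_not[OF definable_conj[OF assms(1) definable_not[OF assms(2)]]] by simp

lemma definable_True: "definable d V (\<lambda>e. True)"
  using definable_eq[OF term_definable_zero term_definable_zero] by simp

lemma definable_False: "definable d V (\<lambda>e. False)"
  using definable_not[OF definable_True] by simp

text \<open>Variables are treated as de Bruijn indices: the witness becomes variable 0 and the other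
  variables are shifted.\<close>

lemma definable_ex:
  assumes "definable d V (\<lambda>e. Q (\<lambda>n. e (Suc n)) (e 0))"
  shows "definable d V (\<lambda>e. \<exists>x. Q e x)"
proof -
  obtain \<phi> where \<phi>: "\<And>e. sat d V e \<phi> \<longleftrightarrow> Q (\<lambda>n. e (Suc n)) (e 0)"
    using assms unfolding definable_def by blast
  \<comment> \<open>Decrementing turns each free index \<open>Suc n\<close> into \<open>n\<close>.
    Index 0 is bound by \<open>FEx 0\<close>, so the truncated \<open>0 - 1\<close> touches no free
    variable.\<close>
  have "sat d V e (rename_form (\<lambda>n. n - 1) (FEx 0 \<phi>)) \<longleftrightarrow> (\<exists>x. Q e x)" for e
    unfolding sat_rename by (simp add: \<phi>)
  then show ?thesis unfolding definable_def by blast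
qed

lemma definable_all:
  assumes "definable d V (\<lambda>e. Q (\<lambda>n. e (Suc n)) (e 0))"
  shows "definable d V (\<lambda>e. \<forall>x. Q e x)"
  using definable_not[OF definable_ex[OF definable_not[OF assms]]] by simp

text \<open>The diagonal sentence needs a syntactic bound on free variables, while
  \<open>definable\<close> is semantic. Mapping every variable to 0 supplies the bound, and
  preserves the meaning because only the value of variable 0 matters.\<close>

lemma definable_unary_formula:
  assumes "definable d V (\<lambda>e. P (e 0))"
  obtains \<phi> where "free_vars \<phi> \<subseteq> {0}" "\<And>e. sat d V e \<phi> \<longleftrightarrow> P (e 0)"
proof -
  obtain \<psi> where \<psi>: "\<And>e. sat d V e \<psi> \<longleftrightarrow> P (e 0)"
    using assms unfolding definable_def by blast
  show thesis
  proof (rule that)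
    show "free_vars (rename_form (\<lambda>_. 0) \<psi>) \<subseteq> {0}"
      using free_vars_rename[of "\<lambda>_. 0" \<psi>] by auto
    show "sat d V e (rename_form (\<lambda>_. 0) \<psi>) \<longleftrightarrow> P (e 0)" for e
      by (simp add: sat_rename \<psi>)
  qed
qed

lemmas definable_intros = definable_eq definable_not definable_conj definable_imp
  definable_ex definable_all term_definable_var term_definable_zero term_definable_one
  term_definable_add term_definable_mult term_definable_der terms_definable_Nil
  terms_definable_Cons terms_definable_append


section \<open>A program for the diagonal function\<close>

fun numeral_term :: "nat \<Rightarrow> vdf_term" where
  "numeral_term 0 = TZero"
| "numeral_term (Suc n) = TPlus (numeral_term n) TOne"

lemma term_vars_numeral: "term_vars (numeral_term n) = {}"
  by (induction n) auto

lemma term_val_numeral: "term_val d e (numeral_term n) = of_nat n"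
  by (induction n) (auto simp: add.commute)

text \<open>The existential witness replaces syntactic substitution: the code of an instance becomes
  a fixed pairing expression in the codes of \<open>\<phi>\<close> and of the numeral, so no program
  has to traverse a formula.\<close>

definition instance_form :: "nat \<Rightarrow> vdf_form \<Rightarrow> vdf_form" where
  "instance_form n \<phi> = FEx 0 (FAnd (FEq (TVar 0) (numeral_term n)) \<phi>)"

lemma sentence_instance: "free_vars \<phi> \<subseteq> {0} \<Longrightarrow> sentence (instance_form n \<phi>)"
  by (auto simp: sentence_def instance_form_def term_vars_numeral)

lemma sat_instance: "sat d V e (instance_form n \<phi>) \<longleftrightarrow> sat d V (e(0 := of_nat n)) \<phi>"
  by (auto simp: instance_form_def term_val_numeral)

section \<open>Programs for arithmetic, pairing and formula codes\<close>

lemma computes_proj: "i < length xs \<Longrightarrow> xs ! i = y \<Longrightarrow> computes (RProj i) xs y"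
  using computes.intros(3) by blast

lemma computes_comp1: "computes g xs y \<Longrightarrow> computes f [y] z \<Longrightarrow> computes (RComp f [g]) xs z"
  by (rule computes.intros(4)[where ys = "[y]"]) auto

lemma computes_comp2:
  "computes g xs y \<Longrightarrow> computes h xs y' \<Longrightarrow> computes f [y, y'] z \<Longrightarrow>
    computes (RComp f [g, h]) xs z"
  by (rule computes.intros(4)[where ys = "[y, y']"]) auto

fun rec_const :: "nat \<Rightarrow> recf" where
  "rec_const 0 = RZero"
| "rec_const (Suc n) = RComp RSucc [rec_const n]"

lemma computes_const: "computes (rec_const n) xs n"
  by (induction n) (auto intro: computes.intros(1,2) computes_comp1)

text \<open>\<open>RPrim\<close> hands its step program the counter, the previous value and then the
  parameters. Hence in this and the later recursions \<open>RProj 1\<close> is the recursive value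
  and \<open>RProj 0\<close> the counter.\<close>

definition rec_add :: recf where
  "rec_add = RPrim (RProj 0) (RComp RSucc [RProj 1])"

lemma computes_add: "computes rec_add [m, n] (m + n)"
  unfolding rec_add_def
proof (induction m)
  case 0
  show ?case by (rule computes.intros(5)) (simp add: computes_proj)
next
  case (Suc m)
  show ?case
    by (rule computes.intros(6)[OF Suc])
      (auto intro!: computes_comp1 computes_proj computes.intros(2))
qed

definition rec_triangle :: recf where
  "rec_triangle = RPrim RZero (RComp rec_add [RProj 1, RComp RSucc [RProj 0]])"

lemma computes_triangle: "computes rec_triangle [n] (triangle n)"
  unfolding rec_triangle_def
proof (induction n)
  case 0
  show ?case by (rule computes.intros(5)) (simp add: computes.intros(1))
next
  case (Suc n)
  have "computes (RComp rec_add [RProj 1, RComp RSucc [RProj 0]]) [n, triangle n]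
      (triangle n + Suc n)"
    by (rule computes_comp2[OF _ _ computes_add])
      (auto intro!: computes_comp1 computes_proj computes.intros(2))
  then show ?case by (intro computes.intros(6)[OF Suc]) simp
qed

text \<open>Mirrors \<open>prod_encode (m, n) = triangle (m + n) + m\<close>. The arguments are
  programs, so nested codes arise by nesting calls.\<close>

definition rec_pair :: "recf \<Rightarrow> recf \<Rightarrow> recf" where
  "rec_pair f g = RComp rec_add [RComp rec_triangle [RComp rec_add [f, g]], f]"

lemma computes_pair:
  assumes "computes f xs m" "computes g xs n"
  shows "computes (rec_pair f g) xs (prod_encode (m, n))"
  unfolding rec_pair_def prod_encode_def
  using computes_comp2[OF computes_comp1[OF computes_comp2[OF assms computes_add]
        computes_triangle] assms(1) computes_add]
  by simp

text \<open>The constant 4 is the tag of \<open>TPlus\<close> in \<open>term_code\<close>.\<close>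

definition rec_numeral_code :: recf where
  "rec_numeral_code = RPrim (rec_const (term_code TZero))
    (rec_pair (rec_const 4) (rec_pair (RProj 1) (rec_const (term_code TOne))))"

lemma computes_numeral_code: "computes rec_numeral_code [n] (term_code (numeral_term n))"
  unfolding rec_numeral_code_def
proof (induction n)
  case 0
  show ?case using computes_const by (auto intro: computes.intros(5))
next
  case (Suc n)
  have "computes (rec_pair (rec_const 4) (rec_pair (RProj 1) (rec_const (term_code TOne))))
      [n, term_code (numeral_term n)] (term_code (numeral_term (Suc n)))"
    unfolding numeral_term.simps term_code.simps(5)
    by (intro computes_pair computes_const computes_proj) auto
  then show ?case by (rule computes.intros(6)[OF Suc])
qed

text \<open>From the outside in: tag 4 of \<open>FEx\<close> and its variable 0, tag 3 of
  \<open>FAnd\<close>, tag 0 of \<open>FEq\<close>. The single input serves both as the number whose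
  numeral is inserted and as the code of the formula; this is the self-application of the diagonal
  argument.\<close>

definition rec_diagonal :: recf where
  "rec_diagonal = rec_pair (rec_const 4) (rec_pair (rec_const 0) (rec_pair (rec_const 3)
    (rec_pair (rec_pair (rec_const 0) (rec_pair (rec_const (term_code (TVar 0))) rec_numeral_code))
      (RProj 0))))"

lemma computes_diagonal:
  "computes rec_diagonal [form_code \<phi>] (form_code (instance_form (form_code \<phi>) \<phi>))"
  unfolding rec_diagonal_def instance_form_def form_code.simps(1,4,5)
  by (intro computes_pair computes_const computes_numeral_code computes_proj) auto


section \<open>Structures that code all sets of natural numbers\<close>

text \<open>Twice the Cantor pairing function. Doubling avoids a division by 2, so this is a term of
  the ring language, and \<open>2 * prod_encode\<close> is still injective on pairs of natural
  numbers.\<close>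

definition twice_pair :: "'a::comm_ring_1 \<Rightarrow> 'a \<Rightarrow> 'a" where
  "twice_pair x y = (x + y) * (x + y + 1) + (x + x)"

lemma twice_pair_of_nat: "twice_pair (of_nat m) (of_nat n) = of_nat (2 * prod_encode (m, n))"
proof -
  have "2 * triangle k = k * (k + 1)" for k by (induction k) auto
  then have "2 * prod_encode (m, n) = (m + n) * (m + n + 1) + (m + m)"
    by (simp add: prod_encode_def)
  then show ?thesis by (simp add: twice_pair_def add_ac del: mult_Suc mult_Suc_right)
qed

lemma Nats_list: "set xs \<subseteq> \<nat> \<longleftrightarrow> (\<exists>ns. xs = map of_nat ns)"
proof
  show "set xs \<subseteq> \<nat> \<Longrightarrow> \<exists>ns. xs = map of_nat ns"
  proof (induction xs)
    case (Cons x xs)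
    then obtain n ns where "x = of_nat n" "xs = map of_nat ns" by (auto elim: Nats_cases)
    then show ?case by (intro exI[of _ "n # ns"]) simp
  qed simp
qed auto

definition computes_in :: "recf \<Rightarrow> 'a::comm_ring_1 list \<Rightarrow> 'a \<Rightarrow> bool" where
  "computes_in p xs y \<longleftrightarrow> (\<exists>ns n. xs = map of_nat ns \<and> y = of_nat n \<and> computes p ns n)"

lemma computes_in_Nats: "computes_in p xs y \<Longrightarrow> set xs \<subseteq> \<nat> \<and> y \<in> \<nat>"
  by (auto simp: computes_in_def)

text \<open>\<open>codes F x\<close> is read as: x lies in the set coded by the element F.
  Quantifiers over elements thus become quantifiers over sets of natural numbers.
  \<open>codes_all\<close> prescribes membership of natural numbers only; a code may contain other
  elements as well.\<close>

locale set_coding =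
  fixes d :: "'a::comm_ring_1 \<Rightarrow> 'a" and V :: "'a set" and codes :: "'a \<Rightarrow> 'a \<Rightarrow> bool"
  assumes of_nat_inject: "of_nat m = (of_nat n :: 'a) \<Longrightarrow> m = n"
    and definable_codes: "term_definable d S \<Longrightarrow> term_definable d T \<Longrightarrow>
      definable d V (\<lambda>e. codes (S e) (T e))"
    and definable_Nats: "term_definable d T \<Longrightarrow> definable d V (\<lambda>e. T e \<in> \<nat>)"
    and codes_all: "\<exists>F. \<forall>n. codes F (of_nat n) \<longleftrightarrow> n \<in> A"
begin

section \<open>Recursion equations for programs over the ring\<close>

lemma map_of_nat_inject: "map of_nat ms = (map of_nat ns :: 'a list) \<longleftrightarrow> ms = ns"
  by (rule inj_map_eq_map) (auto intro!: injI of_nat_inject)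

lemma computes_in_of_nat [simp]:
  "computes_in p (map of_nat ns :: 'a list) (of_nat n) \<longleftrightarrow> computes p ns n"
  unfolding computes_in_def using map_of_nat_inject of_nat_inject by metis

text \<open>The conjunct on \<open>xs\<close> has to be stated separately: if \<open>gs\<close> is
  empty, no subprogram constrains \<open>xs\<close>.\<close>

lemma computes_in_RComp:
  "computes_in (RComp f gs) (xs :: 'a list) z \<longleftrightarrow>
    set xs \<subseteq> \<nat> \<and> (\<exists>ys. list_all2 (\<lambda>g y. computes_in g xs y) gs ys \<and> computes_in f ys z)"
proof
  assume "computes_in (RComp f gs) xs z"
  then obtain ns n where ns: "xs = map of_nat ns" "z = of_nat n" "computes (RComp f gs) ns n"
    by (auto simp: computes_in_def)
  from ns(3) obtain ms where "list_all2 (\<lambda>g m. computes g ns m) gs ms" "computes f ms n"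
    by (rule computes_RCompE)
  then show "set xs \<subseteq> \<nat> \<and> (\<exists>ys. list_all2 (\<lambda>g y. computes_in g xs y) gs ys \<and> computes_in f ys z)"
    by (intro conjI exI[of _ "map of_nat ms"]) (auto simp: ns list_all2_map2)
next
  assume "set xs \<subseteq> \<nat> \<and> (\<exists>ys. list_all2 (\<lambda>g y. computes_in g xs y) gs ys \<and> computes_in f ys z)"
  then obtain ns ms n where ns: "xs = map of_nat ns" "z = of_nat n" "computes f ms n"
      "list_all2 (\<lambda>g y. computes_in g xs y) gs (map of_nat ms)"
    by (auto simp: Nats_list computes_in_def[of f])
  then have "list_all2 (\<lambda>g m. computes g ns m) gs ms" by (simp add: list_all2_map2)
  then have "computes (RComp f gs) ns n" using ns(3) by (rule computes.intros(4))
  then show "computes_in (RComp f gs) xs z" by (simp add: ns)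
qed

text \<open>The graph of a primitive recursion is the smallest set closed under its two equations.\<close>

lemma computes_in_RPrim:
  "computes_in (RPrim f g) (x # xs :: 'a list) y \<longleftrightarrow> set (x # y # xs) \<subseteq> \<nat> \<and>
    (\<forall>F. (\<forall>b. computes_in f xs b \<longrightarrow> codes F (twice_pair 0 b)) \<and>
      (\<forall>m a b. codes F (twice_pair m a) \<and> computes_in g (m # a # xs) b \<longrightarrow>
        codes F (twice_pair (m + 1) b)) \<longrightarrow> codes F (twice_pair x y))"
  (is "?L \<longleftrightarrow> ?N \<and> (\<forall>F. ?C F \<longrightarrow> _)")
proof
  assume L: ?L
  then obtain n ns k where ns: "x = of_nat n" "xs = map of_nat ns" "y = of_nat k"
      "computes (RPrim f g) (n # ns) k"
    by (auto simp: computes_in_def Cons_eq_map_conv)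
  \<comment> \<open>A closed set contains the whole graph, by induction on the recursion
    counter.\<close>
  have "codes F (twice_pair x y)" if C: "?C F" for F
    using ns(4) unfolding ns(1,3)
  proof (induction n arbitrary: k)
    case 0
    then have "computes f ns k" by (rule computes_RPrim_zeroE)
    then have "computes_in f xs (of_nat k)" by (simp add: ns(2))
    then show ?case using C by simp
  next
    case (Suc n)
    from Suc.prems obtain l where l: "computes (RPrim f g) (n # ns) l" "computes g (n # l # ns) k"
      by (rule computes_RPrim_SucE)
    have "computes_in g (map of_nat (n # l # ns) :: 'a list) (of_nat k)"
      using l(2) by (simp only: computes_in_of_nat)
    then have "computes_in g (of_nat n # of_nat l # xs) (of_nat k)" by (simp add: ns(2))
    then have "codes F (twice_pair (of_nat n + 1) (of_nat k))" using C Suc.IH[OF l(1)] by blast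
    then show ?case by (simp add: add.commute)
  qed
  moreover have ?N using computes_in_Nats[OF L] by simp
  ultimately show "?N \<and> (\<forall>F. ?C F \<longrightarrow> codes F (twice_pair x y))" by simp
next
  assume R: "?N \<and> (\<forall>F. ?C F \<longrightarrow> codes F (twice_pair x y))"
  have "x \<in> \<nat>" "y \<in> \<nat>" "set xs \<subseteq> \<nat>" using conjunct1[OF R] by simp_all
  then obtain n k ns where ns: "x = of_nat n" "y = of_nat k" "xs = map of_nat ns"
    by (metis Nats_cases Nats_list)
  \<comment> \<open>The hypothesis is tested on a code of the graph itself, with the parameters
    \<open>ns\<close> fixed. Once this \<open>F\<close> is shown closed, membership of
    \<open>twice_pair x y\<close> is the desired computation.\<close>
  obtain F where F: "\<And>m. codes F (of_nat m) \<longleftrightarrow>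
      m \<in> {2 * prod_encode (i, j) |i j. computes (RPrim f g) (i # ns) j}"
    using codes_all[of "{2 * prod_encode (i, j) |i j. computes (RPrim f g) (i # ns) j}"] by blast
  have F': "codes F (twice_pair (of_nat i) (of_nat j)) \<longleftrightarrow> computes (RPrim f g) (i # ns) j" for i j
    unfolding twice_pair_of_nat F by (auto simp: prod_encode_eq)
  have "codes F (twice_pair 0 b)" if b: "computes_in f xs b" for b
  proof -
    obtain j where j: "b = of_nat j" using computes_in_Nats[OF b] by (metis Nats_cases)
    then have "computes f ns j" using b by (simp add: ns(3))
    then show ?thesis using F'[of 0 j] by (simp add: j computes.intros(5))
  qed
  moreover have "codes F (twice_pair (m + 1) b)"
    if "codes F (twice_pair m a)" "computes_in g (m # a # xs) b" for m a b
  proof -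
    \<comment> \<open>Closure is demanded for arbitrary ring elements, but
      \<open>computes_in g\<close> holds only of natural numbers, where \<open>F\<close> is
      known.\<close>
    have "m \<in> \<nat>" "a \<in> \<nat>" "b \<in> \<nat>" using computes_in_Nats[OF that(2)] by simp_all
    then obtain i j l where ij: "m = of_nat i" "a = of_nat j" "b = of_nat l"
      by (metis Nats_cases)
    have "computes_in g (map of_nat (i # j # ns) :: 'a list) (of_nat l)"
      using that(2) by (simp add: ij ns(3))
    then have "computes g (i # j # ns) l" by (simp only: computes_in_of_nat)
    moreover have "computes (RPrim f g) (i # ns) j" using that(1) by (simp add: ij F')
    ultimately have "computes (RPrim f g) (Suc i # ns) l" by (metis computes.intros(6))
    then show ?thesis using F'[of "Suc i" l] by (simp add: ij add.commute)
  qed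
  ultimately have "codes F (twice_pair x y)" using conjunct2[OF R] by blast
  then have "computes (RPrim f g) (n # ns) k" by (simp add: ns F')
  then have "computes_in (RPrim f g) (map of_nat (n # ns) :: 'a list) (of_nat k)"
    by (simp only: computes_in_of_nat)
  then show ?L by (simp add: ns)
qed

text \<open>The ring has no order, so m < z is expressed by a natural difference, and a positive
  value by \<open>y + 1\<close>. The first conjunct already forces \<open>z\<close> and
  \<open>xs\<close> to be natural.\<close>

lemma computes_in_RMin:
  "computes_in (RMin f) (xs :: 'a list) z \<longleftrightarrow> computes_in f (z # xs) 0 \<and>
    (\<forall>m. m \<in> \<nat> \<and> (\<exists>k. k \<in> \<nat> \<and> z = m + k + 1) \<longrightarrow> (\<exists>y. y \<in> \<nat> \<and> computes_in f (m # xs) (y + 1)))"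
  (is "_ \<longleftrightarrow> _ \<and> ?R xs z")
proof -
  have shift: "computes_in f (of_nat m # map of_nat ns :: 'a list) (of_nat k) \<longleftrightarrow>
      computes f (m # ns) k" for m ns k
    using computes_in_of_nat[of f "m # ns" k] by simp
  have R: "?R (map of_nat ns) (of_nat n) \<longleftrightarrow> (\<forall>m<n. \<exists>y. computes f (m # ns) (Suc y))" for n ns
  proof -
    have "(\<exists>k. k \<in> \<nat> \<and> (of_nat n :: 'a) = of_nat m + k + 1) \<longleftrightarrow> m < n" for m
    proof
      assume "\<exists>k. k \<in> \<nat> \<and> (of_nat n :: 'a) = of_nat m + k + 1"
      then obtain k where "(of_nat n :: 'a) = of_nat m + of_nat k + 1" by (metis Nats_cases)
      then have "(of_nat n :: 'a) = of_nat (m + k + 1)" by (simp add: add_ac)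
      then have "n = m + k + 1" by (rule of_nat_inject)
      then show "m < n" by simp
    next
      assume "m < n"
      then obtain k where "n = m + k + 1" using less_iff_Suc_add by auto
      then show "\<exists>k. k \<in> \<nat> \<and> (of_nat n :: 'a) = of_nat m + k + 1"
        by (intro exI[of _ "of_nat k"]) (simp add: add_ac)
    qed
    moreover have "(\<exists>y. y \<in> \<nat> \<and> computes_in f (of_nat m # map of_nat ns) ((y::'a) + 1)) \<longleftrightarrow>
        (\<exists>y. computes f (m # ns) (Suc y))" for m
    proof -
      have "(\<exists>y. y \<in> \<nat> \<and> computes_in f (of_nat m # map of_nat ns) ((y::'a) + 1)) \<longleftrightarrow>
          (\<exists>y. computes_in f (of_nat m # map of_nat ns) ((of_nat y :: 'a) + 1))"
        by (metis Nats_cases of_nat_in_Nats)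
      then show ?thesis using shift[of m ns "Suc _"] by (simp add: add.commute)
    qed
    ultimately show ?thesis by (metis (no_types, lifting) Nats_cases of_nat_in_Nats)
  qed
  have min: "computes (RMin f) ns n \<longleftrightarrow>
      computes f (n # ns) 0 \<and> (\<forall>m<n. \<exists>y. computes f (m # ns) (Suc y))" for ns n
    by (auto elim: computes_RMinE intro: computes.intros(7))
  show ?thesis
  proof (cases "set xs \<subseteq> \<nat> \<and> z \<in> \<nat>")
    case True
    then obtain n ns where ns: "xs = map of_nat ns" "z = of_nat n"
      by (metis Nats_cases Nats_list)
    show ?thesis unfolding ns R computes_in_of_nat min using shift[of n ns 0] by simp
  next
    case False
    then show ?thesis using computes_in_Nats[of _ xs z] computes_in_Nats[of f "z # xs" 0] by auto
  qed
qed

section \<open>Definability of the graphs of all programs\<close>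

lemma definable_list_Nats:
  assumes "terms_definable d Xs"
  shows "definable d V (\<lambda>e. set (Xs e) \<subseteq> \<nat>)"
proof -
  obtain ts where ts: "\<And>e. map (term_val d e) ts = Xs e"
    using assms unfolding terms_definable_def by metis
  have "definable d V (\<lambda>e. set (map (term_val d e) ts) \<subseteq> \<nat>)"
  proof (induction ts)
    case Nil
    show ?case by (simp add: definable_True)
  next
    case (Cons t ts)
    have "term_definable d (\<lambda>e. term_val d e t)" by (auto simp: term_definable_def)
    then show ?case using Cons by (simp add: definable_conj definable_Nats)
  qed
  then show ?thesis by (simp only: ts)
qed

lemma term_definable_twice_pair:
  "term_definable d S \<Longrightarrow> term_definable d T \<Longrightarrow> term_definable d (\<lambda>e. twice_pair (S e) (T e))"
  unfolding twice_pair_def by (intro definable_intros)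

text \<open>Structural induction on the program, using the recursion equations. Argument list and
  value are arbitrary terms because subprograms are called with quantified variables among their
  arguments.\<close>

lemma definable_computes_in:
  assumes "terms_definable d Xs" "term_definable d Y"
  shows "definable d V (\<lambda>e. computes_in p (Xs e) (Y e))"
  using assms
proof (induction p arbitrary: Xs Y)
  case RZero
  have "computes_in RZero (Xs e) (Y e) \<longleftrightarrow> set (Xs e) \<subseteq> \<nat> \<and> Y e = 0" for e
    unfolding Nats_list computes_in_def
    by (metis computes.intros(1) computes_RZeroE of_nat_0)
  then show ?case
    by (simp only:) (intro definable_intros definable_list_Nats RZero)
next
  case RSucc
  have *: "computes_in RSucc xs y \<longleftrightarrow> (\<exists>x. xs = [x] \<and> x \<in> \<nat> \<and> y = x + 1)" for xs and y :: 'a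
  proof
    assume "computes_in RSucc xs y"
    then show "\<exists>x. xs = [x] \<and> x \<in> \<nat> \<and> y = x + 1"
      by (auto simp: computes_in_def add.commute elim: computes_RSuccE)
  next
    assume "\<exists>x. xs = [x] \<and> x \<in> \<nat> \<and> y = x + 1"
    then obtain n where "xs = map of_nat [n]" "y = of_nat (Suc n)"
      by (auto elim!: Nats_cases simp: add.commute)
    then show "computes_in RSucc xs y" by (simp only: computes_in_of_nat computes.intros(2))
  qed
  from RSucc(1) show ?case
  proof (cases rule: terms_definable_cases)
    case 1
    then show ?thesis by (simp add: * definable_False)
  next
    case (2 S Ss)
    from 2(3) show ?thesis
    proof (cases rule: terms_definable_cases)
      case 1
      have "definable d V (\<lambda>e. S e \<in> \<nat> \<and> Y e = S e + 1)"
        by (intro definable_intros definable_Nats 2 RSucc)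
      then show ?thesis by (simp add: * 1 2(1))
    next
      case 2
      then show ?thesis by (simp add: * \<open>Xs = _\<close> definable_False)
    qed
  qed
next
  case (RProj i)
  obtain ts where ts: "\<And>e. map (term_val d e) ts = Xs e"
    using RProj(1) unfolding terms_definable_def by metis
  have *: "computes_in (RProj i) xs y \<longleftrightarrow> i < length xs \<and> set xs \<subseteq> \<nat> \<and> y = xs ! i"
    for xs and y :: 'a
  proof
    assume "computes_in (RProj i) xs y"
    then show "i < length xs \<and> set xs \<subseteq> \<nat> \<and> y = xs ! i"
      by (auto simp: computes_in_def elim: computes_RProjE)
  next
    assume "i < length xs \<and> set xs \<subseteq> \<nat> \<and> y = xs ! i"
    then show "computes_in (RProj i) xs y"
      by (auto simp: Nats_list intro: computes.intros(3))
  qed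
  show ?case
  proof (cases "i < length ts")
    case True
    have "term_definable d (\<lambda>e. term_val d e (ts ! i))" by (auto simp: term_definable_def)
    then have "definable d V (\<lambda>e. set (Xs e) \<subseteq> \<nat> \<and> Y e = term_val d e (ts ! i))"
      by (intro definable_intros definable_list_Nats RProj)
    then show ?thesis using True by (simp add: * ts[symmetric])
  next
    case False
    then show ?thesis by (simp add: * ts[symmetric] definable_False)
  qed
next
  case (RComp f gs)
  \<comment> \<open>A quantifier over lists is not first-order. Induction on \<open>hs\<close>
    unrolls it into one quantifier per remaining program, while \<open>As\<close> accumulates the
    values already chosen.\<close>
  have "definable d V (\<lambda>e. \<exists>ys. list_all2 (\<lambda>g y. computes_in g (Xs e) y) hs ys \<and>
      computes_in f (As e @ ys) (Y e))"
    if "set hs \<subseteq> set gs" "terms_definable d As" "terms_definable d Xs" "term_definable d Y"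
    for hs As Xs Y
    using that
  proof (induction hs arbitrary: As Xs Y)
    case Nil
    then show ?case using RComp.IH(1) by simp
  next
    case (Cons h hs)
    note defs = terms_definable_rename[OF Cons.prems(2)] terms_definable_rename[OF Cons.prems(3)]
      term_definable_rename[OF Cons.prems(4)]
    have "definable d V (\<lambda>e. \<exists>y. computes_in h (Xs e) y \<and>
        (\<exists>ys. list_all2 (\<lambda>g y. computes_in g (Xs e) y) hs ys \<and>
          computes_in f ((As e @ [y]) @ ys) (Y e)))"
    proof (intro definable_ex definable_conj)
      show "definable d V (\<lambda>e. computes_in h (Xs (\<lambda>n. e (Suc n))) (e 0))"
        by (rule RComp.IH(2)) (use Cons.prems(1) in \<open>auto intro!: term_definable_var defs\<close>)
      show "definable d V (\<lambda>e. \<exists>ys. list_all2 (\<lambda>g y. computes_in g (Xs (\<lambda>n. e (Suc n))) y) hs ys \<and>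
          computes_in f ((As (\<lambda>n. e (Suc n)) @ [e 0]) @ ys) (Y (\<lambda>n. e (Suc n))))"
        by (rule Cons.IH) (use Cons.prems(1) in \<open>auto intro!: definable_intros defs\<close>)
    qed
    moreover have "(\<exists>ys. list_all2 (\<lambda>g y. computes_in g (Xs e) y) (h # hs) ys \<and>
        computes_in f (As e @ ys) (Y e)) \<longleftrightarrow>
        (\<exists>y. computes_in h (Xs e) y \<and> (\<exists>ys. list_all2 (\<lambda>g y. computes_in g (Xs e) y) hs ys \<and>
          computes_in f ((As e @ [y]) @ ys) (Y e)))" for e
      by (auto simp: list_all2_Cons1)
    ultimately show ?case by (simp only:)
  qed
  from this[of gs "\<lambda>e. []", OF order_refl terms_definable_Nil RComp.prems] show ?case
    unfolding computes_in_RComp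
    by (intro definable_conj definable_list_Nats RComp.prems) simp
next
  case (RPrim f g)
  from RPrim.prems(1) show ?case
  proof (cases rule: terms_definable_cases)
    case 1
    have "\<not> computes_in (RPrim f g) [] y" for y :: 'a
      by (auto simp: computes_in_def elim: computes.cases)
    then show ?thesis by (simp add: 1 definable_False)
  next
    case (2 S Ss)
    \<comment> \<open>The renamed versions serve under quantifiers, where each outer variable index
      is shifted.\<close>
    note defs = 2(2,3) RPrim.prems(2) terms_definable_rename[OF 2(3)] term_definable_rename[OF 2(2)]
      term_definable_rename[OF RPrim.prems(2)]
    show ?thesis unfolding 2(1) computes_in_RPrim
      by (intro definable_intros definable_list_Nats definable_codes term_definable_twice_pair
          RPrim.IH defs)
  qed
next
  case (RMin f)
  note defs = RMin.prems terms_definable_rename[OF RMin.prems(1)]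
    term_definable_rename[OF RMin.prems(2)]
  show ?case unfolding computes_in_RMin
    by (intro definable_intros definable_Nats RMin.IH defs)
qed

section \<open>Tarski's diagonal argument\<close>

theorem undecidable: "\<not> decidable (vdf_theory d V)"
proof
  assume "decidable (vdf_theory d V)"
  then obtain p where p: "\<And>n. computes p [n] (if n \<in> form_code ` vdf_theory d V then 1 else 0)"
    unfolding decidable_def recursive_set_def by blast
  \<comment> \<open>On the code of a formula, \<open>q\<close> decides whether the instance of that
    formula at its own code belongs to the theory; value 0 means that it does not.\<close>
  define q where "q = RComp p [rec_diagonal]"
  have "definable d V (\<lambda>e. computes_in q [e 0] 0)"
    by (intro definable_computes_in definable_intros)
  then obtain \<phi> where \<phi>: "free_vars \<phi> \<subseteq> {0}" "\<And>e. sat d V e \<phi> \<longleftrightarrow> computes_in q [e 0] 0"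
    using definable_unary_formula[where P = "\<lambda>x. computes_in q [x] 0"] by blast
  \<comment> \<open>Since \<open>\<phi>\<close> expresses that \<open>q\<close> outputs 0, this
    instance asserts its own absence from the theory.\<close>
  define G where "G = instance_form (form_code \<phi>) \<phi>"
  have q: "computes q [form_code \<phi>] (if form_code G \<in> form_code ` vdf_theory d V then 1 else 0)"
    unfolding q_def G_def by (rule computes_comp1[OF computes_diagonal p])
  have "sat d V e G \<longleftrightarrow> computes q [form_code \<phi>] 0" for e
    using computes_in_of_nat[of q "[form_code \<phi>]" 0] by (simp add: G_def sat_instance \<phi>(2))
  also have "\<dots> \<longleftrightarrow> form_code G \<notin> form_code ` vdf_theory d V"
    using q computes_functional[OF q, of 0] by (auto split: if_splits)
  also have "\<dots> \<longleftrightarrow> G \<notin> vdf_theory d V" by (auto simp: form_code_inject)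
  also have "\<dots> \<longleftrightarrow> \<not> (\<forall>e. sat d V e G)"
    using sentence_instance[OF \<phi>(1)] by (simp add: vdf_theory_def G_def)
  \<comment> \<open>The right-hand side does not depend on \<open>e\<close>: if \<open>G\<close>
    held everywhere, it would fail, and if it failed somewhere, it would hold everywhere.\<close>
  finally show False by blast
qed

end


section \<open>Supports of Hahn series\<close>

lemma wfp_on_less_singleton: "wfp_on {a :: 'a::linorder} (<)"
  by (auto simp: wfp_on_iff_ex_minimal subset_singleton_iff)

definition hahn_const :: "'c \<Rightarrow> ('g::linordered_ab_group_add, 'c::comm_ring_1) hahn" where
  "hahn_const c = Abs_hahn (\<lambda>\<gamma>. if \<gamma> = 0 then c else 0)"

lemma hahn_coeff_const:
  fixes \<gamma> :: "'g::linordered_ab_group_add"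
  shows "hahn_coeff (hahn_const c) \<gamma> = (if \<gamma> = 0 then c else 0)"
proof -
  have "wfp_on {\<gamma>::'g. (if \<gamma> = 0 then c else 0) \<noteq> 0} (<)"
    by (rule wfp_on_subset[OF wfp_on_less_singleton[of 0]]) auto
  then show ?thesis by (simp add: hahn_const_def Abs_hahn_inverse)
qed

lemma hahn_coeff_const_mult: "hahn_coeff (hahn_const c * f) \<gamma> = c * hahn_coeff f \<gamma>"
proof -
  note wf0 = wfp_on_less_singleton[of 0]
  have wf1: "wfp_on (insert \<gamma> (hahn_supp f)) (<)"
    using wfp_on_less_Un[OF wfp_on_less_singleton hahn_supp_wf, of \<gamma> f] by simp
  have "conv_pairs {0} (insert \<gamma> (hahn_supp f)) \<gamma> = {(0, \<gamma>)}" by (auto simp: conv_pairs_def)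
  then show ?thesis
    by (subst coeff_times_superset[OF wf0 wf1]) (auto simp: hahn_supp_def hahn_coeff_const)
qed

lemma of_nat_hahn: "of_nat n = hahn_const (of_nat n)"
  by (induction n)
    (auto intro!: hahn_eqI simp: hahn_coeff_const zero_hahn.rep_eq one_hahn.rep_eq plus_hahn.rep_eq)

text \<open>The exponent \<open>\<gamma>\<close> is represented in the field by the constant series \<open>\<iota> \<gamma>\<close>.\<close>

definition resonant :: "('a::comm_ring_1 \<Rightarrow> 'a) \<Rightarrow> 'a \<Rightarrow> 'a \<Rightarrow> bool" where
  "resonant d f x \<longleftrightarrow> d x = 0 \<and> \<not> (\<exists>g. d g = x * g + f)"

lemma resonant_iff_support:
  fixes f :: "('g::linordered_idom, 'c::field_char_0) hahn"
  assumes "inj \<iota>" "\<iota> 0 = 0"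
  shows "resonant (hahn_tddt \<iota>) f x \<longleftrightarrow> (\<exists>\<gamma>\<in>hahn_supp f. x = hahn_const (\<iota> \<gamma>))"
proof (cases "hahn_tddt \<iota> x = 0")
  case True
  \<comment> \<open>The kernel of the derivation consists of constant series, as
    \<open>\<iota> \<gamma>\<close> vanishes only at 0.\<close>
  have "hahn_coeff x \<gamma> = 0" if "\<gamma> \<noteq> 0" for \<gamma>
  proof -
    have "\<iota> \<gamma> * hahn_coeff x \<gamma> = 0"
      using True by (metis hahn_tddt.rep_eq zero_hahn.rep_eq)
    moreover have "\<iota> \<gamma> \<noteq> 0" using that assms by (metis injD)
    ultimately show ?thesis by simp
  qed
  then have "x = hahn_const (hahn_coeff x 0)"
    by (intro hahn_eqI) (simp add: hahn_coeff_const)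
  then obtain c where x: "x = hahn_const c" by blast
  have const: "hahn_const c = (hahn_const c' :: ('g, 'c) hahn) \<longleftrightarrow> c = c'" for c c'
    by (metis hahn_coeff_const)
  have eq: "hahn_tddt \<iota> g = x * g + f \<longleftrightarrow> (\<forall>\<gamma>. (\<iota> \<gamma> - c) * hahn_coeff g \<gamma> = hahn_coeff f \<gamma>)" for g
  proof -
    have "hahn_tddt \<iota> g = x * g + f \<longleftrightarrow>
        (\<forall>\<gamma>. hahn_coeff (hahn_tddt \<iota> g) \<gamma> = hahn_coeff (x * g + f) \<gamma>)"
      by (metis hahn_eqI)
    also have "\<dots> \<longleftrightarrow> (\<forall>\<gamma>. \<iota> \<gamma> * hahn_coeff g \<gamma> = c * hahn_coeff g \<gamma> + hahn_coeff f \<gamma>)"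
      by (simp only: x hahn_tddt.rep_eq plus_hahn.rep_eq hahn_coeff_const_mult)
    finally show ?thesis by (simp add: algebra_simps)
  qed
  have "(\<exists>g. hahn_tddt \<iota> g = x * g + f) \<longleftrightarrow> \<not> (\<exists>\<gamma>\<in>hahn_supp f. c = \<iota> \<gamma>)"
  proof
    assume "\<exists>g. hahn_tddt \<iota> g = x * g + f"
    then obtain g where g: "\<And>\<gamma>. (\<iota> \<gamma> - c) * hahn_coeff g \<gamma> = hahn_coeff f \<gamma>"
      unfolding eq by blast
    have "hahn_coeff f \<gamma> = 0" if "c = \<iota> \<gamma>" for \<gamma> using g[of \<gamma>] that by simp
    then show "\<not> (\<exists>\<gamma>\<in>hahn_supp f. c = \<iota> \<gamma>)" by (auto simp: hahn_supp_def)
  next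
    assume no: "\<not> (\<exists>\<gamma>\<in>hahn_supp f. c = \<iota> \<gamma>)"
    \<comment> \<open>Coefficientwise division keeps the support inside that of \<open>f\<close>,
      hence well-ordered. Where \<open>\<iota> \<gamma> = c\<close>, division by zero yields 0,
      which is a correct choice because the coefficient of \<open>f\<close> vanishes there.\<close>
    define g where "g = Abs_hahn (\<lambda>\<gamma>. hahn_coeff f \<gamma> / (\<iota> \<gamma> - c))"
    have "wfp_on {\<gamma>. hahn_coeff f \<gamma> / (\<iota> \<gamma> - c) \<noteq> 0} (<)"
      by (rule wfp_on_subset[OF hahn_supp_wf[of f]]) (auto simp: hahn_supp_def)
    then have "hahn_coeff g \<gamma> = hahn_coeff f \<gamma> / (\<iota> \<gamma> - c)" for \<gamma>
      by (simp add: g_def Abs_hahn_inverse)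
    then have "(\<iota> \<gamma> - c) * hahn_coeff g \<gamma> = hahn_coeff f \<gamma>" for \<gamma>
      using no by (cases "\<iota> \<gamma> = c") (auto simp: hahn_supp_def)
    then show "\<exists>g. hahn_tddt \<iota> g = x * g + f" unfolding eq by blast
  qed
  then show ?thesis unfolding resonant_def using True by (simp add: x const)
next
  case False
  \<comment> \<open>If x is not a constant of the derivation, both sides fail: the right-hand side
    would make x a constant series.\<close>
  have "hahn_tddt \<iota> (hahn_const c) = 0" for c
    by (rule hahn_eqI) (simp add: hahn_tddt.rep_eq hahn_coeff_const zero_hahn.rep_eq assms)
  then show ?thesis using False by (auto simp: resonant_def)
qed

section \<open>Series with a prescribed set of natural exponents\<close>

lemma wfp_on_of_nat_image: "wfp_on (of_nat ` A :: 'g::linordered_idom set) (<)"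
  unfolding wfp_on_less_iff_no_descending
proof
  assume "\<exists>s. \<forall>n::nat. s n \<in> (of_nat ` A :: 'g set) \<and> s (Suc n) < s n"
  then obtain s where s: "\<And>n::nat. s n \<in> (of_nat ` A :: 'g set)" "\<And>n. s (Suc n) < s n"
    by blast
  have "\<forall>n. \<exists>m. s n = of_nat m" using s(1) by blast
  then obtain k where k: "\<And>n. s n = of_nat (k n)" by metis
  then have "k (Suc n) < k n" for n using s(2)[of n] by simp
  moreover have "wfp_on UNIV ((<) :: nat \<Rightarrow> nat \<Rightarrow> bool)" by simp
  ultimately show False unfolding wfp_on_less_iff_no_descending by blast
qed

lemma ex_hahn_supp_of_nat:
  "\<exists>f :: ('g::linordered_idom, 'c::comm_ring_1) hahn. hahn_supp f = of_nat ` A"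
proof
  let ?c = "\<lambda>\<gamma>::'g. if \<gamma> \<in> of_nat ` A then 1 else 0 :: 'c"
  have "wfp_on {\<gamma>. ?c \<gamma> \<noteq> 0} (<)" by (simp add: wfp_on_of_nat_image)
  then show "hahn_supp (Abs_hahn ?c) = of_nat ` A"
    by (simp add: hahn_supp_def Abs_hahn_inverse)
qed

text \<open>Treats both exponent groups at once. As \<open>\<iota>\<close> fixes the natural
  numbers, the exponent n is represented in the field by \<open>of_nat n\<close>, so resonance of
  \<open>f\<close> codes the natural numbers in its support.\<close>

lemma undecidable_hahn:
  fixes \<iota> :: "'g::linordered_idom \<Rightarrow> 'c::field_char_0"
  assumes inj: "inj \<iota>" and nat: "\<And>n. \<iota> (of_nat n) = of_nat n"
  shows "\<not> decidable (vdf_theory (hahn_tddt \<iota>) V)"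
proof -
  let ?d = "hahn_tddt \<iota> :: ('g, 'c) hahn \<Rightarrow> ('g, 'c) hahn"
  have zero: "\<iota> 0 = 0" using nat[of 0] by simp
  have inject: "m = n" if "of_nat m = (of_nat n :: ('g, 'c) hahn)" for m n
    using that unfolding of_nat_hahn by (metis hahn_coeff_const of_nat_eq_iff)
  have res: "resonant ?d f (of_nat n) \<longleftrightarrow> of_nat n \<in> hahn_supp f" for f n
  proof -
    have "resonant ?d f (of_nat n) \<longleftrightarrow> (\<exists>\<gamma>\<in>hahn_supp f. \<iota> (of_nat n) = \<iota> \<gamma>)"
      unfolding resonant_iff_support[OF inj zero] of_nat_hahn nat by (metis hahn_coeff_const)
    then show ?thesis using inj by (auto simp: inj_eq)
  qed
  have codes_all: "\<exists>f. \<forall>n. resonant ?d f (of_nat n) \<longleftrightarrow> n \<in> A" for A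
  proof -
    obtain f :: "('g, 'c) hahn" where "hahn_supp f = of_nat ` A"
      using ex_hahn_supp_of_nat by blast
    then show ?thesis by (intro exI[of _ f]) (auto simp: res)
  qed
  have def_res: "definable ?d V (\<lambda>e. resonant ?d (S e) (T e))"
    if "term_definable ?d S" "term_definable ?d T" for S T
    unfolding resonant_def
    by (intro definable_intros that that[THEN term_definable_rename])
  have Nats: "x \<in> \<nat> \<longleftrightarrow>
      (\<forall>f. resonant ?d f 0 \<and> (\<forall>y. resonant ?d f y \<longrightarrow> resonant ?d f (y + 1)) \<longrightarrow> resonant ?d f x)"
    (is "_ \<longleftrightarrow> (\<forall>f. ?ind f \<longrightarrow> _)") for x
  proof
    assume "x \<in> \<nat>"
    then obtain n where n: "x = of_nat n" by (rule Nats_cases)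
    have "resonant ?d f (of_nat n)" if "?ind f" for f
      using that by (induction n) (auto simp: add.commute[of 1])
    then show "\<forall>f. ?ind f \<longrightarrow> resonant ?d f x" by (simp add: n)
  next
    assume all: "\<forall>f. ?ind f \<longrightarrow> resonant ?d f x"
    obtain f :: "('g, 'c) hahn" where f: "hahn_supp f = of_nat ` UNIV"
      using ex_hahn_supp_of_nat by blast
    \<comment> \<open>This \<open>f\<close> is resonant at no field element outside the natural
      numbers. That makes it inductive, with y ranging over the whole field, and gives
      minimality.\<close>
    have rf: "resonant ?d f y \<longleftrightarrow> y \<in> \<nat>" for y
      unfolding resonant_iff_support[OF inj zero] f by (auto simp: nat of_nat_hahn Nats_def)
    then have "?ind f" by simp
    then show "x \<in> \<nat>" using all rf by blast
  qed
  have def_Nats: "definable ?d V (\<lambda>e. T e \<in> \<nat>)" if "term_definable ?d T" for T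
    unfolding Nats
    by (intro definable_intros def_res term_definable_rename[OF that])
  interpret set_coding ?d V "resonant ?d"
    by unfold_locales (fact inject def_res def_Nats codes_all)+
  show ?thesis by (rule undecidable)
qed

theorem mainTheorem12:
  shows "\<not> decidable (vdf_theory
      (hahn_tddt of_int :: (int, 'c::field_char_0) hahn \<Rightarrow> (int, 'c) hahn) hahn_val_ring)
    \<and> \<not> decidable (vdf_theory
      (hahn_tddt of_rat :: (rat, 'c) hahn \<Rightarrow> (rat, 'c) hahn) hahn_val_ring)"
  \<comment> \<open>Characteristic zero makes \<open>of_int\<close> and \<open>of_rat\<close>
    injective.\<close>
  by (intro conjI undecidable_hahn) (auto intro!: injI)

end
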